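(* Let $q$ be a prime power, $s\ge 1$, and let $N>1$ be an integer with $N-1\mid q^s-1$. Let $\Delta$ be a nonempty subset of $\{0,1,\dots,N-1\}$ with $0\in\Delta$, and let $d=d(\Delta)=\max\Delta$. For each $b\in\mathcal{B}$ let $\xi_b$ be a primitive element of the field $\mathbb{F}_{q^{n_b}}$. Then a basis of the $\mathbb{F}_q$-vector space $\mathrm{PRS}(N,\Delta)_q$ is given by the image under $\mathrm{ev}_{X_N}$ of the following polynomials. If $\mathfrak{I}_d\subset\Delta$: $$\bigcup_{b\in \mathcal{B},\ \mathfrak{I}_b\subset \Delta,\ b< d}\{\mathcal{T}_b^h(\xi_b^r x_1^b)\mid 0\leq r\leq n_b-1 \} \cup \{\mathcal{T}_d^h(x_1^d) \}.$$ If $\mathfrak{I}_d\not\subset\Delta$: $$\bigcup_{b\in \mathcal{B},\ \mathfrak{I}_b\subset \Delta}\{\mathcal{T}_b^h(\xi_b^r x_1^b)\mid 0\leq r\leq n_b-1 \}.$$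
   Context: Points and codes. $Y_N=\{z\in\mathbb{F}_{q^s}: z^N=z\}$ (it has $N$ elements), and $X_N=\{(1,z): z\in Y_N\}\cup\{(0,1)\}\subset \mathbb{F}_{q^s}^2$ (it has $N+1$ elements). For $f\in\mathbb{F}_{q^s}[x_0,x_1]$, $\mathrm{ev}_{X_N}(f)=(f(P))_{P\in X_N}\in\mathbb{F}_{q^s}^{N+1}$ (with $0^0=1$). $\mathrm{PRS}(N,\Delta)$ is the $\mathbb{F}_{q^s}$-linear code spanned by $\{\mathrm{ev}_{X_N}(x_0^{d(\Delta)-i}x_1^i): i\in\Delta\}$, and $\mathrm{PRS}(N,\Delta)_q=\mathrm{PRS}(N,\Delta)\cap\mathbb{F}_q^{N+1}$ is its subfield subcode. Cyclotomic sets. Let $\mathbb{Z}_N=\{0\}\cup\mathbb{Z}/\langle N-1\rangle$, where the classes of $\mathbb{Z}/\langle N-1\rangle$ are represented by $\{1,\dots,N-1\}$ (so $0$ and $N-1$ are distinct elements and $q\cdot 0=0$); thus $\mathbb{Z}_N$ is identified with $\{0,1,\dots,N-1\}$. For $z\in\mathbb{Z}_N$ the minimal cyclotomic set (with respect to $q$) of $z$ is $\mathfrak{I}_z=\{q^i\cdot z: i\ge 0\}$, and $n_z=|\mathfrak{I}_z|$. $\mathcal{B}$ is the set of maximal representatives (largest elements) of the minimal cyclotomic sets. Homogenized traces. For $b\in\mathcal{B}$ and $f\in\mathbb{F}_{q^s}[x_1]$, $\mathcal{T}_b(f)$ is the class of $f+f^q+\cdots+f^{q^{n_b-1}}$ modulo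 $x_1^N-x_1$, represented by the polynomial whose exponents are all in $\{0,\dots,N-1\}$. When this representative has degree at most $d=d(\Delta)$, $\mathcal{T}_b^h(f)$ denotes its homogenization up to degree $d$, i.e. $x_0^d\,g(x_1/x_0)$ where $g=\mathcal{T}_b(f)$. *)

theory Defs
  imports
    "HOL-Computational_Algebra.Computational_Algebra"
    "HOL-Number_Theory.Prime_Powers"
    "HOL-Library.Cardinality"
begin

section \<open>Subfields of the ambient finite field\<close>

text \<open>
  The ambient field \<open>\<F>\<^sub>Q\<close>, with \<open>Q = q\<^sup>s\<close>, is a type of class \<^class>\<open>finite_field\<close>.
  The subfield with \<open>m\<close> elements, for the appropriate \<open>m\<close>, is the set of roots of
  \<open>x\<^sup>m - x\<close>; lemma \<open>subfield_card_iff_GF\<close> below shows that this set is the unique subfield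
  with \<open>m\<close> elements.
\<close>

definition GF :: "nat \<Rightarrow> 'a::finite_field set" where
  "GF m = {x. x ^ m = x}"

definition is_subfield :: "'a::field set \<Rightarrow> bool" where
  "is_subfield K \<longleftrightarrow> 0 \<in> K \<and> 1 \<in> K \<and>
     (\<forall>x\<in>K. \<forall>y\<in>K. x + y \<in> K \<and> x * y \<in> K) \<and>
     (\<forall>x\<in>K. - x \<in> K \<and> inverse x \<in> K)"

lemma finite_field_CHAR_eq:
  assumes "CARD('a::finite_field) = p ^ k" "prime p"
  shows "CHAR('a) = p"
proof -
  have "(\<Sum>x\<in>UNIV. x + 1) = (\<Sum>x\<in>UNIV. x :: 'a)"
    by (rule sum.reindex_bij_witness[of _ "\<lambda>x. x - 1" "\<lambda>x. x + 1"]) auto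
  hence "of_nat (CARD('a)) = (0 :: 'a)"
    by (simp add: sum.distrib)
  hence "CHAR('a) dvd p ^ k"
    using assms by (simp only: of_nat_eq_0_iff_char_dvd)
  thus ?thesis
    by (meson CHAR_prime assms(2) prime_dvd_power primes_dvd_imp_eq)
qed

lemma is_subfield_GF:
  assumes "CARD('a::finite_field) = q ^ s" "primepow q"
  shows "is_subfield (GF (q ^ n) :: 'a set)"
proof -
  obtain p k where pk: "prime p" "k > 0" "q = p ^ k"
    using assms(2) by (auto simp: primepow_def)
  have "CARD('a) = p ^ (k * s)"
    using assms(1) pk by (simp add: power_mult)
  with pk have char: "CHAR('a) = p"
    using finite_field_CHAR_eq by blast
  have add: "(x + y) ^ (q ^ n) = x ^ (q ^ n) + y ^ (q ^ n)" for x y :: 'a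
    by (rule freshmans_dream'[where n = "k * n"]) (simp_all add: char pk power_mult)
  have pos: "q ^ n > 0"
    using pk prime_gt_0_nat by simp
  have neg: "(- x) ^ (q ^ n) = - (x ^ (q ^ n))" for x :: 'a
  proof -
    have "x ^ (q ^ n) + (- x) ^ (q ^ n) = 0"
      using add[of x "- x"] pos by (metis add.right_inverse power_0_left less_numeral_extra(3))
    thus ?thesis by (simp add: eq_neg_iff_add_eq_0 add.commute)
  qed
  show ?thesis
    using pos by (auto simp: is_subfield_def GF_def add neg power_mult_distrib
                  power_inverse power_0_left)
qed

lemma pred_dvd_pred_power:
  fixes a :: nat
  assumes "a > 0"
  shows "a - 1 dvd a ^ n - 1"
proof (induction n)
  case (Suc n)
  have "a ^ Suc n - 1 = a ^ n * (a - 1) + (a ^ n - 1)"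
    using assms by (simp add: algebra_simps diff_mult_distrib2 flip: Suc_le_eq)
  with Suc show ?case by simp
qed simp

lemma card_power_eq_le:
  assumes "e > 0"
  shows "card {x :: 'a::finite_field. x ^ e = c} \<le> e"
proof -
  let ?p = "monom 1 e - [:c:] :: 'a poly"
  have "coeff ?p e = 1"
    using assms by (simp add: coeff_eq_0)
  hence "?p \<noteq> 0" by (metis coeff_0 zero_neq_one)
  moreover have "degree ?p \<le> e"
    by (rule degree_diff_le) (auto simp: degree_monom_le)
  ultimately show ?thesis
    using card_poly_roots_bound[of ?p] by (simp add: poly_monom)
qed

lemma card_roots_of_unity_finite_field:
  assumes "e dvd CARD('a::finite_field) - 1"
  shows "card {x :: 'a. x ^ e = 1} = e"
proof -
  have Q: "CARD('a) \<ge> 2"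
    using card_mono[of UNIV "{0, 1 :: 'a}"] by simp
  obtain m where m: "CARD('a) - 1 = e * m"
    using assms by (elim dvdE)
  with Q have em: "e > 0" "m > 0"
    by (auto intro!: Nat.gr0I)
  let ?U = "UNIV - {0 :: 'a}" and ?R = "{x :: 'a. x ^ e = 1}"
  have one: "x ^ (CARD('a) - 1) = 1" if "x \<noteq> 0" for x :: 'a
  proof -
    have "x * x ^ (CARD('a) - 1) = x * 1"
      using finite_field_power_card_eq_same[of x] Q by (simp flip: power_Suc)
    thus ?thesis using that by simp
  qed
  have "?U \<subseteq> (\<Union>y\<in>?R. {x. x ^ m = y})"
  proof
    fix x :: 'a assume "x \<in> ?U"
    hence "(x ^ m) ^ e = 1"
      using one[of x] unfolding m by (simp add: mult.commute flip: power_mult)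
    thus "x \<in> (\<Union>y\<in>?R. {x. x ^ m = y})" by simp
  qed
  hence "card ?U \<le> card (\<Union>y\<in>?R. {x. x ^ m = y})"
    by (intro card_mono) auto
  also have "\<dots> \<le> (\<Sum>y\<in>?R. card {x. x ^ m = y})"
    by (rule card_UN_le) simp
  also have "\<dots> \<le> card ?R * m"
    using sum_bounded_above[of ?R "\<lambda>y. card {x. x ^ m = y}" m] card_power_eq_le[OF em(2)]
    by auto
  finally have "e * m \<le> card ?R * m"
    by (simp add: m[symmetric] card_Diff_singleton)
  with em have "e \<le> card ?R" by simp
  with card_power_eq_le[OF em(1), of "1 :: 'a"] show ?thesis by simp
qed

lemma GF_eq_insert:
  assumes "m > 1"
  shows "(GF m :: 'a::finite_field set) = insert 0 {x. x ^ (m - 1) = 1}"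
proof -
  have "x ^ m = x \<longleftrightarrow> x = 0 \<or> x ^ (m - 1) = 1" for x :: 'a
    using assms power_Suc[of x "m - 1"] by auto
  thus ?thesis by (auto simp: GF_def)
qed

lemma card_GF:
  assumes "CARD('a::finite_field) = q ^ s" "primepow q" "n dvd s" "s \<ge> 1"
  shows "card (GF (q ^ n) :: 'a set) = q ^ n"
proof -
  have "n > 0" using assms by (auto intro: Nat.gr0I)
  moreover have "q > 1" using primepow_gt_Suc_0[OF assms(2)] by simp
  ultimately have gt: "q ^ n > 1" by (metis one_less_power)
  obtain r where "s = n * r" using assms(3) by (elim dvdE)
  hence "q ^ n - 1 dvd CARD('a) - 1"
    using pred_dvd_pred_power[of "q ^ n" r] gt assms(1) \<open>q > 1\<close> by (auto simp: power_mult)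
  hence "card {x :: 'a. x ^ (q ^ n - 1) = 1} = q ^ n - 1"
    by (rule card_roots_of_unity_finite_field)
  thus ?thesis
    using gt by (simp add: GF_eq_insert card_insert_if power_0_left)
qed

lemma subfield_card_iff_GF:
  fixes K :: "'a::finite_field set"
  assumes "CARD('a) = q ^ s" "primepow q" "n dvd s" "s \<ge> 1"
  shows "is_subfield K \<and> card K = q ^ n \<longleftrightarrow> K = GF (q ^ n)"
proof
  assume K: "is_subfield K \<and> card K = q ^ n"
  have "x ^ card K = x" if x: "x \<in> K" for x
  proof (cases "x = 0")
    case False
    let ?K = "K - {0}"
    have 0: "0 \<in> K" using K by (simp add: is_subfield_def)
    hence pos: "card K > 0" by (auto simp: card_gt_0_iff)
    have "(\<Prod>y\<in>?K. x * y) = (\<Prod>y\<in>?K. y)"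
      by (rule prod.reindex_bij_witness[of _ "\<lambda>y. inverse x * y" "\<lambda>y. x * y"])
        (use False K x in \<open>auto simp: is_subfield_def\<close>)
    hence "x ^ (card K - 1) * \<Prod>?K = \<Prod>?K"
      using 0 by (simp add: prod.distrib card_Diff_singleton)
    hence "x ^ (card K - 1) = 1" by simp
    thus ?thesis using pos power_Suc[of x "card K - 1"] by simp
  qed (use K primepow_gt_Suc_0[OF assms(2)] in \<open>auto simp: power_0_left\<close>)
  with K have "K \<subseteq> GF (q ^ n)" by (auto simp: GF_def)
  with K card_GF[where 'a = 'a, OF assms] show "K = GF (q ^ n)"
    by (intro card_subset_eq) auto
qed (use is_subfield_GF[OF assms(1,2)] card_GF[OF assms] in auto)

text \<open>
  A primitive element of a finite field \<open>K\<close> is a generator of its multiplicative group.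
\<close>

definition primitive_element :: "'a::field set \<Rightarrow> 'a \<Rightarrow> bool" where
  "primitive_element K \<xi> \<longleftrightarrow> range (\<lambda>k::nat. \<xi> ^ k) = K - {0}"


section \<open>Linear algebra over a subfield\<close>

text \<open>
  Vectors are functions on a finite type and the scalars range over a subfield \<open>K\<close>. All sets of
  vectors are finite here, so no sum below is over an infinite set.
\<close>

definition lin_span :: "'a::finite_field set \<Rightarrow> ('p::finite \<Rightarrow> 'a) set \<Rightarrow> ('p \<Rightarrow> 'a) set" where
  "lin_span K B = {(\<lambda>P. \<Sum>v\<in>B. c v * v P) | c. \<forall>v\<in>B. c v \<in> K}"

definition lin_indep :: "'a::finite_field set \<Rightarrow> ('p::finite \<Rightarrow> 'a) set \<Rightarrow> bool" where
  "lin_indep K B \<longleftrightarrow>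
     (\<forall>c. (\<forall>v\<in>B. c v \<in> K) \<and> (\<forall>P. (\<Sum>v\<in>B. c v * v P) = 0) \<longrightarrow> (\<forall>v\<in>B. c v = 0))"

definition is_basis ::
    "'a::finite_field set \<Rightarrow> ('p::finite \<Rightarrow> 'a) set \<Rightarrow> ('p \<Rightarrow> 'a) set \<Rightarrow> bool" where
  "is_basis K B V \<longleftrightarrow> lin_indep K B \<and> lin_span K B = V"


section \<open>Points and codes\<close>

definition Y_pts :: "nat \<Rightarrow> 'a::finite_field set" where
  "Y_pts N = {z. z ^ N = z}"

definition X_pts :: "nat \<Rightarrow> ('a::finite_field \<times> 'a) set" where
  "X_pts N = {(1, z) | z. z \<in> Y_pts N} \<union> {(0, 1)}"

text \<open>
  A polynomial in \<open>F[x\<^sub>0,x\<^sub>1]\<close> is an element of \<open>F[x\<^sub>0][x\<^sub>1]\<close>: the variable of the outer polynomial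
  is \<open>x\<^sub>1\<close>, that of its coefficients is \<open>x\<^sub>0\<close>.
\<close>

definition bmonom :: "'a::comm_ring_1 \<Rightarrow> nat \<Rightarrow> nat \<Rightarrow> 'a poly poly" where
  "bmonom c i j = monom (monom c i) j"  \<comment> \<open>\<open>c x\<^sub>0\<^sup>i x\<^sub>1\<^sup>j\<close>\<close>

definition bpoly :: "'a::comm_ring_1 poly poly \<Rightarrow> 'a \<times> 'a \<Rightarrow> 'a" where
  "bpoly f P = poly (poly f [:snd P:]) (fst P)"

lemma bpoly_bmonom: "bpoly (bmonom c i j) (x0, x1) = c * x0 ^ i * x1 ^ j"
  by (simp add: bpoly_def bmonom_def poly_monom poly_power)

text \<open>
  The space \<open>F\<^bsup>N+1\<^esup>\<close>, with coordinates indexed by \<open>X\<^sub>N\<close>, is realised as the functions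
  on \<open>F\<^sup>2\<close> vanishing outside \<open>X\<^sub>N\<close>.
\<close>

definition ev :: "nat \<Rightarrow> 'a::finite_field poly poly \<Rightarrow> ('a \<times> 'a \<Rightarrow> 'a)" where
  "ev N f = (\<lambda>P. if P \<in> X_pts N then bpoly f P else 0)"

definition PRS :: "nat \<Rightarrow> nat set \<Rightarrow> ('a::finite_field \<times> 'a \<Rightarrow> 'a) set" where
  "PRS N \<Delta> = lin_span UNIV {ev N (bmonom 1 (Max \<Delta> - i) i) | i. i \<in> \<Delta>}"

definition PRS_sub :: "nat \<Rightarrow> nat \<Rightarrow> nat set \<Rightarrow> ('a::finite_field \<times> 'a \<Rightarrow> 'a) set" where
  "PRS_sub q N \<Delta> = PRS N \<Delta> \<inter> {w. \<forall>P\<in>X_pts N. w P \<in> GF q}"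


section \<open>Cyclotomic sets\<close>

text \<open>
  \<open>zmul N a z\<close> is the product \<open>a \<cdot> z\<close> in \<open>\<int>\<^sub>N\<close>, for \<open>a \<ge> 1\<close> and \<open>z < N\<close>: nonzero elements are
  multiplied modulo \<open>N - 1\<close>, with the representative of the result taken in \<open>{1,\<dots>,N-1}\<close>.
\<close>

definition zmul :: "nat \<Rightarrow> nat \<Rightarrow> nat \<Rightarrow> nat" where
  "zmul N a z = (if z = 0 then 0 else (a * z - 1) mod (N - 1) + 1)"

definition cyc :: "nat \<Rightarrow> nat \<Rightarrow> nat \<Rightarrow> nat set" where
  "cyc q N z = {zmul N (q ^ i) z | i. True}"

definition cyc_card :: "nat \<Rightarrow> nat \<Rightarrow> nat \<Rightarrow> nat" where
  "cyc_card q N z = card (cyc q N z)"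

definition max_reps :: "nat \<Rightarrow> nat \<Rightarrow> nat set" where
  "max_reps q N = {Max (cyc q N z) | z. z < N}"


section \<open>Homogenized traces\<close>

definition trace_poly :: "nat \<Rightarrow> nat \<Rightarrow> nat \<Rightarrow> 'a::finite_field poly \<Rightarrow> 'a poly" where
  "trace_poly q N b f = (\<Sum>i<cyc_card q N b. f ^ (q ^ i)) mod (monom 1 N - monom 1 1)"

text \<open>
  The homogenization \<open>x\<^sub>0\<^sup>d g(x\<^sub>1/x\<^sub>0)\<close>, meaningful for \<open>degree g \<le> d\<close>.
\<close>

definition homogenize :: "nat \<Rightarrow> 'a::comm_ring_1 poly \<Rightarrow> 'a poly poly" where
  "homogenize d g = (\<Sum>i\<le>d. bmonom (coeff g i) (d - i) i)"

definition hom_trace :: "nat \<Rightarrow> nat \<Rightarrow> nat \<Rightarrow> nat \<Rightarrow> 'a::finite_field poly \<Rightarrow> 'a poly poly" where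
  "hom_trace q N d b f = homogenize d (trace_poly q N b f)"

end

(* A word of PRS(N, Delta) is given by its coefficients c, supported in Delta. Comparing f with f^q
   on the N points (1, z), where a polynomial of degree below N is determined by its values, the
   word has entries in F_q iff c(q i) = c(i)^q for all i and c(d), its entry at (0, 1), lies in F_q.
   Such a c vanishes on every cyclotomic set not contained in Delta, and on the others it is
   determined by c(b), an arbitrary element of F_{q^{n_b}} (of F_q if b = d): on I_b it is the trace
   of c(b) x^b. Since the first n_b powers of xi_b form a basis of F_{q^{n_b}} over F_q, the claim
   follows. *)

theory Submission
  imports Defs "HOL-Number_Theory.Cong"
begin

section \<open>Bases of spaces of vectors\<close>

text \<open>The obstacle is the point (0,1). On the points (1,z) alone, the subfield subcode splits
  into one copy of F_{q^{n_b}} for each cyclotomic set inside \<Delta>; the entry at (0,1) adds a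
  condition on c(d) only. Maximal representatives confine it to one fibre: a representative b with
  I_b inside \<Delta> satisfies b \<le> d, and if d lies in I_b then d \<le> b, so b = d. Both cases
  of the theorem therefore follow from one statement, \<open>trace_basis\<close>, in which the fibre
  over b may carry any F_q-basis of its space of admissible c(b). That space is F_{q^{n_b}} for b
  \<noteq> d because going once around I_b turns c(b) into c(b)^(q^{n_b}); as n_b divides s, this
  field lies in the ambient field with its full number of elements. The elements 0 and N - 1 are
  kept apart because z^0 and z^(N-1) agree at every nonzero z of Y_N but not at z = 0.\<close>

text \<open>\<open>is_basis\<close> is about sets, whereas the vectors come as indexed families. A
  collision \<open>v i = v j\<close> would be a relation with coefficients 1 and -1, so independence
  of the family already makes \<open>v\<close> injective, and sums over the image can be
  reindexed.\<close>

lemma is_basis_image: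
  fixes v :: "'i \<Rightarrow> ('p::finite \<Rightarrow> 'a::finite_field)"
  assumes K: "is_subfield K" and fin: "finite I"
    and indep: "\<And>c i. \<lbrakk>\<And>i. i \<in> I \<Longrightarrow> c i \<in> K; \<And>P. (\<Sum>i\<in>I. c i * v i P) = 0; i \<in> I\<rbrakk> \<Longrightarrow> c i = 0"
    and span: "V = {(\<lambda>P. \<Sum>i\<in>I. c i * v i P) | c. \<forall>i\<in>I. c i \<in> K}"
  shows "is_basis K (v ` I) V"
proof -
  have inj: "inj_on v I"
  proof (rule inj_onI, rule ccontr)
    fix i j assume ij: "i \<in> I" "j \<in> I" "v i = v j" "i \<noteq> j"
    define c where "c = (\<lambda>k. if k = i then 1 else if k = j then -1 else (0::'a))"
    have "(\<Sum>k\<in>I. c k * v k P) = 0" for P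
    proof -
      have "(\<Sum>k\<in>I. c k * v k P) = (\<Sum>k\<in>{i,j}. c k * v k P)"
        using ij fin by (intro sum.mono_neutral_right) (auto simp: c_def)
      thus ?thesis using ij by (simp add: c_def)
    qed
    moreover have "c k \<in> K" for k
      using K by (auto simp: c_def is_subfield_def)
    ultimately have "c i = 0"
      by (intro indep[of c i] ij(1))
    thus False by (simp add: c_def)
  qed
  have "lin_indep K (v ` I)"
    unfolding lin_indep_def
  proof (intro allI impI)
    fix c assume c: "(\<forall>w\<in>v ` I. c w \<in> K) \<and> (\<forall>P. (\<Sum>w\<in>v ` I. c w * w P) = 0)"
    have "(c \<circ> v) i = 0" if "i \<in> I" for i
      using c that by (intro indep[of "c \<circ> v" i]) (auto simp: sum.reindex[OF inj])
    thus "\<forall>w\<in>v ` I. c w = 0" by auto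
  qed
  moreover have "lin_span K (v ` I) = V"
    unfolding span lin_span_def
  proof (intro equalityI subsetI)
    fix w assume "w \<in> {\<lambda>P. \<Sum>x\<in>v ` I. c x * x P | c. \<forall>x\<in>v ` I. c x \<in> K}"
    then obtain c where "w = (\<lambda>P. \<Sum>x\<in>v ` I. c x * x P)" "\<forall>x\<in>v ` I. c x \<in> K" by blast
    thus "w \<in> {\<lambda>P. \<Sum>i\<in>I. c i * v i P | c. \<forall>i\<in>I. c i \<in> K}"
      by (auto simp: sum.reindex[OF inj] intro!: exI[of _ "c \<circ> v"])
  next
    fix w assume "w \<in> {\<lambda>P. \<Sum>i\<in>I. c i * v i P | c. \<forall>i\<in>I. c i \<in> K}"
    then obtain c where "w = (\<lambda>P. \<Sum>i\<in>I. c i * v i P)" "\<forall>i\<in>I. c i \<in> K" by blast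
    thus "w \<in> {\<lambda>P. \<Sum>x\<in>v ` I. c x * x P | c. \<forall>x\<in>v ` I. c x \<in> K}"
      by (auto simp: sum.reindex[OF inj] inv_into_f_f[OF inj] intro!: exI[of _ "c \<circ> inv_into I v"])
  qed
  ultimately show ?thesis by (simp add: is_basis_def)
qed

lemma is_subfield_UNIV: "is_subfield UNIV"
  by (simp add: is_subfield_def)

lemma is_subfield_sum:
  assumes "is_subfield K" "\<And>i. i \<in> I \<Longrightarrow> f i \<in> K"
  shows "(\<Sum>i\<in>I. f i) \<in> K"
  using assms(2) by (induction I rule: infinite_finite_induct)
    (use assms(1) in \<open>auto simp: is_subfield_def\<close>)

lemma is_subfield_mult: "is_subfield K \<Longrightarrow> x \<in> K \<Longrightarrow> y \<in> K \<Longrightarrow> x * y \<in> K"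
  by (simp add: is_subfield_def)

lemma is_subfield_add: "is_subfield K \<Longrightarrow> x \<in> K \<Longrightarrow> y \<in> K \<Longrightarrow> x + y \<in> K"
  by (simp add: is_subfield_def)

lemma is_subfield_uminus: "is_subfield K \<Longrightarrow> x \<in> K \<Longrightarrow> - x \<in> K"
  by (simp add: is_subfield_def)

lemma is_subfield_divide: "is_subfield K \<Longrightarrow> x \<in> K \<Longrightarrow> y \<in> K \<Longrightarrow> x / y \<in> K"
  by (simp add: is_subfield_def divide_inverse)

section \<open>Power bases\<close>

text \<open>
  If \<open>\<xi>\<close> satisfied a nontrivial relation of degree \<open>m < n\<close>, then all powers of \<open>\<xi>\<close> would lie in
  the span of \<open>1, \<dots>, \<xi>\<^bsup>m-1\<^esup>\<close>, which has at most \<open>|K|\<^sup>m\<close> elements.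
\<close>

lemma primitive_powers_indep:
  fixes K L :: "'a::finite_field set"
  assumes K: "is_subfield K" and L: "is_subfield L" "card L = card K ^ n"
    and \<xi>: "primitive_element L \<xi>"
    and c: "\<And>r. r < n \<Longrightarrow> c r \<in> K" "(\<Sum>r<n. c r * \<xi> ^ r) = 0" and "r < n"
  shows "c r = 0"
proof (rule ccontr)
  assume "c r \<noteq> 0"
  define m where "m = Max {r. r < n \<and> c r \<noteq> 0}"
  have "m \<in> {r. r < n \<and> c r \<noteq> 0}"
    unfolding m_def using \<open>c r \<noteq> 0\<close> \<open>r < n\<close> by (intro Max_in) auto
  hence m: "m < n" "c m \<noteq> 0" by auto
  have above: "c k = 0" if "m < k" "k < n" for k
  proof (rule ccontr)
    assume "c k \<noteq> 0"
    hence "k \<le> m" unfolding m_def using that by (intro Max_ge) auto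
    thus False using that by simp
  qed
  have "(\<Sum>r<n. c r * \<xi> ^ r) = (\<Sum>r<Suc m. c r * \<xi> ^ r)"
    using m above by (intro sum.mono_neutral_right) auto
  hence "(\<Sum>r<m. c r * \<xi> ^ r) + c m * \<xi> ^ m = 0" using c(2) by simp
  hence "c m * \<xi> ^ m = - (\<Sum>r<m. c r * \<xi> ^ r)" by (simp add: add_eq_0_iff)
  hence "\<xi> ^ m = - (\<Sum>r<m. c r * \<xi> ^ r) / c m" using m(2) by (simp add: field_simps)
  also have "\<dots> = (\<Sum>r<m. (- c r / c m) * \<xi> ^ r)"
    by (simp add: sum_divide_distrib sum_negf)
  finally have \<xi>m: "\<xi> ^ m = (\<Sum>r<m. (- c r / c m) * \<xi> ^ r)" .
  define S where "S = (\<lambda>g. \<Sum>r<m. g r * \<xi> ^ r) ` ({..<m} \<rightarrow>\<^sub>E K)"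
  have SI: "(\<Sum>r<m. g r * \<xi> ^ r) \<in> S" if "\<And>r. r < m \<Longrightarrow> g r \<in> K" for g
    unfolding S_def using that by (intro image_eqI[where x = "restrict g {..<m}"]) auto
  have step: "\<xi> * x \<in> S" if x: "x \<in> S" for x
  proof -
    obtain g where g: "x = (\<Sum>r<m. g r * \<xi> ^ r)" "g \<in> {..<m} \<rightarrow>\<^sub>E K"
      using x unfolding S_def by blast
    show ?thesis
    proof (cases m)
      case 0 thus ?thesis using x g by simp
    next
      case (Suc l)
      \<comment> \<open>Multiplication by \<xi> shifts the coefficients up by one; the overflowing
        term \<open>g l * \<xi> ^ m\<close> is expanded again by the relation
        \<open>\<xi>m\<close>.\<close>
      define h where "h r = (case r of 0 \<Rightarrow> 0 | Suc r' \<Rightarrow> g r') + g l * (- c r / c m)" for r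
      have "\<xi> * x = (\<Sum>r<m. g r * \<xi> ^ Suc r)"
        by (simp add: g sum_distrib_left algebra_simps)
      also have "\<dots> = (\<Sum>r<l. g r * \<xi> ^ Suc r) + g l * \<xi> ^ m" by (simp add: Suc)
      also have "(\<Sum>r<l. g r * \<xi> ^ Suc r) = (\<Sum>r<m. (case r of 0 \<Rightarrow> 0 | Suc r' \<Rightarrow> g r') * \<xi> ^ r)"
        unfolding Suc by (subst sum.lessThan_Suc_shift) simp
      also have "g l * \<xi> ^ m = (\<Sum>r<m. g l * (- c r / c m) * \<xi> ^ r)"
        by (subst \<xi>m) (simp add: sum_distrib_left mult.assoc)
      finally have "\<xi> * x = (\<Sum>r<m. h r * \<xi> ^ r)"
        by (simp only: h_def sum.distrib distrib_right)
      moreover have "h r \<in> K" if "r < m" for r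
        unfolding h_def
      proof (intro is_subfield_add[OF K] is_subfield_mult[OF K] is_subfield_divide[OF K]
          is_subfield_uminus[OF K])
        show "(case r of 0 \<Rightarrow> 0 | Suc r' \<Rightarrow> g r') \<in> K"
          using K g(2) that by (cases r) (auto simp: is_subfield_def PiE_def Pi_def)
        show "g l \<in> K" using g(2) Suc by auto
        show "c r \<in> K" "c m \<in> K" using c(1) m that by auto
      qed
      ultimately show ?thesis using SI[of h] by simp
    qed
  qed
  have one: "1 \<in> S"
  proof (cases m)
    \<comment> \<open>For \<open>m = 0\<close> the relation \<open>\<xi>m\<close> reads 1 =
      0.\<close>
    case 0 thus ?thesis using \<xi>m by simp
  next
    case (Suc l)
    have "(\<Sum>r<m. (if r = 0 then 1 else 0) * \<xi> ^ r) \<in> S"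
      using K by (intro SI) (auto simp: is_subfield_def)
    also have "(\<Sum>r<m. (if r = 0 then 1 else 0) * \<xi> ^ r) = 1"
      unfolding Suc by (subst sum.lessThan_Suc_shift) simp
    finally show ?thesis .
  qed
  have pow: "\<xi> ^ k \<in> S" for k
    by (induction k) (use one step in auto)
  have "0 \<in> S" using SI[of "\<lambda>_. 0"] K unfolding is_subfield_def by simp
  have "L \<subseteq> S"
  proof
    fix x assume "x \<in> L"
    hence "x = 0 \<or> x \<in> range (\<lambda>k. \<xi> ^ k)" using \<xi> by (simp add: primitive_element_def)
    thus "x \<in> S" using pow \<open>0 \<in> S\<close> by (elim disjE imageE) simp_all
  qed
  hence "card L \<le> card S" by (intro card_mono) auto
  also have "\<dots> \<le> card ({..<m} \<rightarrow>\<^sub>E K)"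
    unfolding S_def by (intro card_image_le finite_PiE) auto
  also have "\<dots> = card K ^ m" by (simp add: card_PiE)
  finally have "card K ^ n \<le> card K ^ m" using L by simp
  moreover have "card K \<ge> 2"
    using card_mono[of K "{0,1}"] K by (simp add: is_subfield_def)
  ultimately show False using m(1) by simp
qed

text \<open>A counting argument: by independence the map from coefficient tuples over K to L is
  injective, and both sides have \<open>card K ^ n\<close> elements.\<close>

lemma primitive_powers_span:
  fixes K L :: "'a::finite_field set"
  assumes K: "is_subfield K" and L: "is_subfield L" "card L = card K ^ n" and KL: "K \<subseteq> L"
    and \<xi>: "primitive_element L \<xi>" and x: "x \<in> L"
  shows "\<exists>c. (\<forall>r<n. c r \<in> K) \<and> x = (\<Sum>r<n. c r * \<xi> ^ r)"
proof -
  define F where "F g = (\<Sum>r<n. g r * \<xi> ^ r)" for g :: "nat \<Rightarrow> 'a"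
  have inj: "inj_on F ({..<n} \<rightarrow>\<^sub>E K)"
  proof (rule inj_onI)
    fix g h assume gh: "g \<in> {..<n} \<rightarrow>\<^sub>E K" "h \<in> {..<n} \<rightarrow>\<^sub>E K" "F g = F h"
    have "g r - h r = 0" if "r < n" for r
    proof (rule primitive_powers_indep[OF K L \<xi> _ _ that])
      show "(\<Sum>r<n. (g r - h r) * \<xi> ^ r) = 0"
        using gh(3) by (simp add: F_def left_diff_distrib sum_subtractf)
      show "g k - h k \<in> K" if "k < n" for k
        using is_subfield_add[OF K _ is_subfield_uminus[OF K], of "g k" "h k"] gh that by auto
    qed
    thus "g = h" using gh(1,2) by (intro PiE_ext[of g _ "\<lambda>_. K" h]) auto
  qed
  have "\<xi> ^ r \<in> L" for r
    using \<xi> by (auto simp: primitive_element_def)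
  hence "F ` ({..<n} \<rightarrow>\<^sub>E K) \<subseteq> L"
    using KL by (auto simp: F_def intro!: is_subfield_sum[OF L(1)] is_subfield_mult[OF L(1)])
  moreover have "card (F ` ({..<n} \<rightarrow>\<^sub>E K)) = card L"
    by (simp add: card_image[OF inj] card_PiE L)
  ultimately have "F ` ({..<n} \<rightarrow>\<^sub>E K) = L"
    by (intro card_subset_eq) auto
  then obtain g where "g \<in> {..<n} \<rightarrow>\<^sub>E K" "x = F g" using x by blast
  thus ?thesis by (intro exI[of _ g]) (auto simp: F_def)
qed

section \<open>Cyclotomic sets\<close>

text \<open>\<open>step\<close> makes \<open>g\<close> the orbit of a map, and the return at
  \<open>s\<close> excludes a preperiod. So \<open>g\<close> is purely periodic, and its least
  period is the size of its range, which is how \<open>cyc_card\<close> is defined.\<close>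

lemma card_range_periodic:
  fixes g :: "nat \<Rightarrow> 'b"
  assumes step: "\<And>i j. g i = g j \<Longrightarrow> g (Suc i) = g (Suc j)" and s: "g s = g 0" "s > 0"
  defines "n \<equiv> card (range g)"
  shows "n > 0" "g n = g 0" "inj_on g {..<n}" "g ` {..<n} = range g" "n dvd s"
proof -
  define p where "p = (LEAST p. p > 0 \<and> g p = g 0)"
  have p: "p > 0" "g p = g 0"
    using LeastI[of "\<lambda>p. p > 0 \<and> g p = g 0" s] s by (auto simp: p_def)
  have least: "g k \<noteq> g 0" if "k > 0" "k < p" for k
    using not_less_Least[of k "\<lambda>p. p > 0 \<and> g p = g 0"] that by (auto simp: p_def)
  have shift: "g (i + k) = g (j + k)" if "g i = g j" for i j k
    by (induction k) (use that in \<open>auto intro!: step\<close>)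
  have mult: "g (i + k * p) = g i" for i k
  proof (induction k)
    case (Suc k)
    have "g (p + (i + k * p)) = g (0 + (i + k * p))" by (rule shift) (rule p)
    thus ?case using Suc by (simp add: add_ac)
  qed simp
  have mod: "g i = g (i mod p)" for i
    using mult[of "i mod p" "i div p"] by (simp add: add.commute)
  have neq: "g i \<noteq> g j" if "i < j" "j < p" for i j
  proof
    assume "g i = g j"
    \<comment> \<open>Shifting by \<open>p - i\<close> moves the first index to the period, so
      \<open>j - i\<close> would be a return time to \<open>g 0\<close> smaller than
      \<open>p\<close>.\<close>
    hence "g (i + (p - i)) = g (j + (p - i))" by (rule shift)
    also have "j + (p - i) = (j - i) + 1 * p" using that by simp
    finally have "g p = g (j - i)" using that mult[of "j - i" 1] by simp
    with p least[of "j - i"] that show False by simp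
  qed
  have inj: "inj_on g {..<p}"
  proof (rule inj_onI)
    fix i j assume "i \<in> {..<p}" "j \<in> {..<p}" "g i = g j"
    thus "i = j" using neq[of i j] neq[of j i] by (cases i j rule: linorder_cases) auto
  qed
  have im: "g ` {..<p} = range g"
  proof (intro equalityI subsetI)
    fix x assume "x \<in> range g"
    then obtain i where "x = g (i mod p)" using mod by blast
    thus "x \<in> g ` {..<p}" using p by simp
  qed auto
  have "card (g ` {..<p}) = p" using inj by (simp add: card_image)
  hence n: "n = p" by (simp add: n_def im)
  \<comment> \<open>The remainder is again a return time and is below \<open>p\<close>, so
    minimality forces it to be 0.\<close>
  have "s mod p = 0"
    using least[of "s mod p"] mod[of s] s p by (metis mod_less_divisor neq0_conv)
  thus "n > 0" "g n = g 0" "inj_on g {..<n}" "g ` {..<n} = range g" "n dvd s"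
    using p inj im n by auto
qed

section \<open>Multiplication in Z_N\<close>

lemma zmul_0 [simp]: "zmul N a 0 = 0"
  by (simp add: zmul_def)

lemma zmul_pos [simp]: "zmul N a z > 0 \<longleftrightarrow> z > 0"
  by (simp add: zmul_def)

lemma zmul_less:
  assumes "N > 1"
  shows "zmul N a z < N"
proof -
  have "(a * z - 1) mod (N - 1) < N - 1"
    using assms by (intro mod_less_divisor) auto
  hence "(a * z - 1) mod (N - 1) + 1 < N" by linarith
  thus ?thesis using assms by (simp add: zmul_def)
qed

lemma cong_zmul:
  assumes "a > 0" "z > 0"
  shows "[zmul N a z = a * z] (mod (N - 1))"
proof -
  have "[(a * z - 1) mod (N - 1) + 1 = (a * z - 1) + 1] (mod (N - 1))"
    by (intro cong_add) (auto simp: cong_def)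
  thus ?thesis using assms by (simp add: zmul_def)
qed

text \<open>Each residue class modulo N - 1 has exactly one representative in {1,...,N-1}, so a
  congruence and a range check identify a product without unfolding \<open>zmul\<close>.\<close>

lemma zmul_eqI:
  assumes "a > 0" "z > 0" "x > 0" "x < N" "[x = a * z] (mod (N - 1))"
  shows "zmul N a z = x"
proof -
  have "[x - 1 + 1 = a * z - 1 + 1] (mod (N - 1))"
    using assms by simp
  hence "[x - 1 = a * z - 1] (mod (N - 1))"
    by (simp only: cong_add_rcancel_nat)
  hence "(a * z - 1) mod (N - 1) = (x - 1) mod (N - 1)"
    by (simp add: cong_def)
  also have "\<dots> = x - 1" using assms by simp
  finally show ?thesis using assms by (simp add: zmul_def)
qed

lemma zmul_zmul:
  assumes "N > 1" "a > 0" "b > 0"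
  shows "zmul N a (zmul N b z) = zmul N (a * b) z"
proof (cases "z = 0")
  case False
  have "[zmul N (a * b) z = a * b * z] (mod (N - 1))"
    using assms False by (intro cong_zmul) auto
  also have "[a * b * z = a * zmul N b z] (mod (N - 1))"
    using assms False cong_scalar_left[OF cong_sym[OF cong_zmul[of b z N]], of a]
    by (simp add: mult.assoc)
  finally show ?thesis
    using assms False by (intro zmul_eqI) (auto simp: zmul_less)
qed simp

lemma zmul_1:
  assumes "z < N"
  shows "zmul N 1 z = z"
proof (cases "z = 0")
  case False thus ?thesis using assms by (intro zmul_eqI) auto
qed simp

text \<open>The type argument only ties the ambient field to \<open>q\<close> and \<open>s\<close>.\<close>

locale cyclotomic_code =
  fixes q s N :: nat and F :: "'a::finite_field itself"
  assumes q: "primepow q" and s: "s \<ge> 1" and card_F: "CARD('a) = q ^ s"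
    and N: "N > 1" and N_dvd: "N - 1 dvd q ^ s - 1"
begin

lemma q_gt_1: "q > 1"
  using primepow_gt_Suc_0[OF q] by simp

lemma q_pos [simp]: "q > 0"
  using q_gt_1 by simp

lemma zmul_power: "zmul N (q ^ i) (zmul N (q ^ j) z) = zmul N (q ^ (i + j)) z"
  using N by (subst zmul_zmul) (auto simp: power_add)

lemma zmul_power_s:
  assumes "z < N"
  shows "zmul N (q ^ s) z = z"
proof (cases "z = 0")
  case False
  have "[q ^ s = 1] (mod (N - 1))"
    using N_dvd cong_altdef_nat[of 1 "q ^ s" "N - 1"] by (simp add: Suc_le_eq)
  hence "[q ^ s * z = 1 * z] (mod (N - 1))" by (rule cong_scalar_right)
  hence "[z = q ^ s * z] (mod (N - 1))" unfolding mult_1 by (rule cong_sym)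
  thus ?thesis using assms False by (intro zmul_eqI) auto
qed simp

text \<open>As q^s acts as the identity, multiplication by q permutes {0,...,N-1}. The explicit
  inverse serves to reindex the q-th power of a polynomial function by its new exponents.\<close>

lemma zmul_inverse:
  assumes "z < N"
  shows "zmul N (q ^ (s - 1)) (zmul N q z) = z" "zmul N q (zmul N (q ^ (s - 1)) z) = z"
proof -
  have "s - 1 + 1 = s" "1 + (s - 1) = s" using s by simp_all
  thus "zmul N (q ^ (s - 1)) (zmul N q z) = z" "zmul N q (zmul N (q ^ (s - 1)) z) = z"
    using zmul_power[of "s - 1" 1 z] zmul_power[of 1 "s - 1" z] zmul_power_s[OF assms]
    by (metis power_one_right)+
qed

text \<open>The orbit facts behind all later arguments on cyclotomic sets. The last one, that n_z
  divides s, is what \<open>card_GF\<close> requires for the field with q^{n_z} elements.\<close>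

lemma zmul_orbit:
  assumes "z < N"
  shows "cyc_card q N z > 0" "zmul N (q ^ cyc_card q N z) z = z"
    "inj_on (\<lambda>k. zmul N (q ^ k) z) {..<cyc_card q N z}"
    "(\<lambda>k. zmul N (q ^ k) z) ` {..<cyc_card q N z} = cyc q N z"
    "cyc_card q N z dvd s"
proof -
  let ?g = "\<lambda>k. zmul N (q ^ k) z"
  have step: "?g (Suc i) = ?g (Suc j)" if "?g i = ?g j" for i j
  proof -
    have "?g (1 + i) = ?g (1 + j)" unfolding zmul_power[symmetric] that ..
    thus ?thesis by simp
  qed
  have 0: "?g s = ?g 0" using assms zmul_power_s[OF assms] zmul_1[OF assms] by simp
  have c: "cyc q N z = range ?g" by (auto simp: cyc_def)
  have s0: "s > 0" using s by simp
  have z: "?g 0 = z" using assms zmul_1[of z N] by simp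
  note * = card_range_periodic[of ?g s, OF step 0 s0]
  show "cyc_card q N z > 0" unfolding cyc_card_def c by (rule *(1))
  show "zmul N (q ^ cyc_card q N z) z = z" unfolding cyc_card_def c using *(2) z by (rule trans)
  show "inj_on ?g {..<cyc_card q N z}" unfolding cyc_card_def c by (rule *(3))
  show "?g ` {..<cyc_card q N z} = cyc q N z" unfolding cyc_card_def c by (rule *(4))
  show "cyc_card q N z dvd s" unfolding cyc_card_def c by (rule *(5))
qed

section \<open>Cyclotomic sets as the classes of a partition\<close>

lemma cyc_less: "i \<in> cyc q N z \<Longrightarrow> i < N"
  using N by (auto simp: cyc_def zmul_less)

lemma cyc_self: "z < N \<Longrightarrow> z \<in> cyc q N z"
  unfolding cyc_def using zmul_1[of z N] by (intro CollectI exI[of _ 0]) simp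

lemma cyc_finite [simp]: "finite (cyc q N z)"
  by (rule finite_subset[of _ "{..<N}"]) (auto intro: cyc_less)

lemma cyc_zmul: "i \<in> cyc q N z \<Longrightarrow> zmul N (q ^ k) i \<in> cyc q N z"
  by (auto simp: cyc_def zmul_power)

lemma cyc_subset: "i \<in> cyc q N z \<Longrightarrow> cyc q N i \<subseteq> cyc q N z"
  by (auto simp: cyc_def zmul_power)

lemma cyc_sym:
  assumes "z < N" "i \<in> cyc q N z"
  shows "z \<in> cyc q N i"
proof -
  have "i \<in> (\<lambda>k. zmul N (q ^ k) z) ` {..<cyc_card q N z}"
    using assms zmul_orbit by simp
  then obtain k where k: "k < cyc_card q N z" "i = zmul N (q ^ k) z" by blast
  \<comment> \<open>The remaining \<open>cyc_card q N z - k\<close> steps complete one turn of the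
    orbit and lead from \<open>i\<close> back to \<open>z\<close>.\<close>
  have "z = zmul N (q ^ (cyc_card q N z - k)) i"
    using k zmul_orbit(2)[OF assms(1)] by (simp add: zmul_power)
  thus ?thesis unfolding cyc_def by blast
qed

lemma cyc_eq: "z < N \<Longrightarrow> i \<in> cyc q N z \<Longrightarrow> cyc q N i = cyc q N z"
  using cyc_subset cyc_sym by blast

lemma max_reps_iff: "b \<in> max_reps q N \<longleftrightarrow> b < N \<and> Max (cyc q N b) = b"
proof (intro iffI conjI)
  assume "b \<in> max_reps q N"
  then obtain z where z: "z < N" "Max (cyc q N z) = b" unfolding max_reps_def by blast
  have b: "b \<in> cyc q N z" unfolding z(2)[symmetric] using cyc_self[OF z(1)] by (intro Max_in) auto
  show "b < N" using b by (rule cyc_less)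
  show "Max (cyc q N b) = b" unfolding cyc_eq[OF z(1) b] by (rule z(2))
next
  assume "b < N \<and> Max (cyc q N b) = b"
  thus "b \<in> max_reps q N" unfolding max_reps_def mem_Collect_eq by (intro exI[of _ b]) simp
qed

lemma max_reps_unique:
  assumes "b \<in> max_reps q N" "b' \<in> max_reps q N" "i \<in> cyc q N b" "i \<in> cyc q N b'"
  shows "b = b'"
proof -
  have b: "b < N" "Max (cyc q N b) = b" and b': "b' < N" "Max (cyc q N b') = b'"
    using assms(1,2) unfolding max_reps_iff by blast+
  have "cyc q N b = cyc q N b'"
    using cyc_eq[OF b(1) assms(3)] cyc_eq[OF b'(1) assms(4)] by (rule trans[OF sym])
  hence "Max (cyc q N b) = Max (cyc q N b')" by (rule arg_cong)
  thus ?thesis unfolding b(2) b'(2) .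
qed

lemma max_reps_exists:
  assumes "i < N"
  obtains b where "b \<in> max_reps q N" "i \<in> cyc q N b" "cyc q N b = cyc q N i"
proof (rule that)
  have *: "Max (cyc q N i) \<in> cyc q N i" using cyc_self[OF assms] by (intro Max_in) auto
  show "Max (cyc q N i) \<in> max_reps q N" unfolding max_reps_def using assms by blast
  show "i \<in> cyc q N (Max (cyc q N i))" using assms * by (rule cyc_sym)
  show "cyc q N (Max (cyc q N i)) = cyc q N i" using assms * by (rule cyc_eq)
qed

section \<open>The Frobenius map and polynomial functions\<close>

lemma frob_add: "(x + y :: 'a) ^ (q ^ n) = x ^ (q ^ n) + y ^ (q ^ n)"
proof -
  obtain p k where pk: "prime p" "k > 0" "q = p ^ k"
    using q by (auto simp: primepow_def)
  have "CARD('a) = p ^ (k * s)" using card_F pk by (simp add: power_mult)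
  hence char: "CHAR('a) = p" using pk finite_field_CHAR_eq by blast
  show ?thesis
    by (rule freshmans_dream'[where n = "k * n"]) (simp_all add: char pk power_mult)
qed

lemma frob_sum: "(\<Sum>i\<in>A. f i :: 'a) ^ (q ^ n) = (\<Sum>i\<in>A. f i ^ (q ^ n))"
  by (induction A rule: infinite_finite_induct) (auto simp: frob_add power_0_left)

lemma GF_subfield: "is_subfield (GF (q ^ n) :: 'a set)"
  using is_subfield_GF card_F q by blast

lemma GF_q_subfield: "is_subfield (GF q :: 'a set)"
  using GF_subfield[of 1] by simp

lemma GF_power: "(x::'a) \<in> GF q \<Longrightarrow> x ^ (q ^ k) = x"
  by (induction k) (auto simp: GF_def power_mult)

lemma GF_q_subset: "(GF q :: 'a set) \<subseteq> GF (q ^ n)"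
  using GF_power by (auto simp: GF_def)

text \<open>Y_N consists of 0 and the (N-1)-th roots of unity, all N - 1 of which lie in the field
  because N - 1 divides the order of its multiplicative group.\<close>

lemma card_Y: "card (Y_pts N :: 'a set) = N"
proof -
  have "Y_pts N = (GF N :: 'a set)" by (simp add: Y_pts_def GF_def)
  moreover have "card {x :: 'a. x ^ (N - 1) = 1} = N - 1"
    using N_dvd card_F by (intro card_roots_of_unity_finite_field) simp
  ultimately show ?thesis
    using N by (simp add: GF_eq_insert card_insert_if power_0_left)
qed

text \<open>A nonzero z in Y_N satisfies z^(N-1) = 1, so only the exponent modulo N - 1 matters. At
  z = 0 only its being zero matters, and \<open>zmul\<close> preserves that.\<close>

lemma Y_power_zmul:
  assumes "(z::'a) \<in> Y_pts N"
  shows "z ^ zmul N q i = z ^ (q * i)"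
proof (cases "z = 0 \<or> i = 0")
  case True
  thus ?thesis by (cases "i = 0") (auto simp: power_0_left zmul_def)
next
  case False
  have "z * z ^ (N - 1) = z * 1"
    using assms N power_Suc[of z "N - 1"] by (simp add: Y_pts_def)
  hence z1: "z ^ (N - 1) = 1" using False by simp
  have red: "z ^ k = z ^ (k mod (N - 1))" for k
  proof -
    have "z ^ k = z ^ ((N - 1) * (k div (N - 1)) + k mod (N - 1))" by simp
    also have "\<dots> = z ^ (k mod (N - 1))"
      unfolding power_add power_mult z1 by simp
    finally show ?thesis .
  qed
  have "zmul N q i mod (N - 1) = (q * i) mod (N - 1)"
    using cong_zmul[of q i N] False by (simp add: cong_def)
  thus ?thesis using red by metis
qed

lemma poly_fun_eq_0:
  fixes c :: "nat \<Rightarrow> 'a"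
  assumes "\<And>z. z \<in> Y_pts N \<Longrightarrow> (\<Sum>i<N. c i * z ^ i) = 0" "i < N"
  shows "c i = 0"
proof -
  define p where "p = (\<Sum>i<N. monom (c i) i)"
  have coeff: "coeff p j = (if j < N then c j else 0)" for j
    by (simp add: p_def coeff_sum)
  have "p = 0"
  proof (rule ccontr)
    assume "p \<noteq> 0"
    have deg: "degree p \<le> N - 1" by (rule degree_le) (auto simp: coeff)
    have "Y_pts N \<subseteq> {z. poly p z = 0}"
      using assms(1) by (auto simp: p_def poly_sum poly_monom)
    hence "N \<le> card {z. poly p z = 0}"
      using card_mono[of "{z. poly p z = 0}" "Y_pts N"] card_Y by simp
    also have "\<dots> \<le> degree p" using \<open>p \<noteq> 0\<close> by (rule card_poly_roots_bound)
    finally show False using deg N by simp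
  qed
  thus ?thesis using coeff[of i] assms(2) by simp
qed

lemma poly_fun_subfield_iff:
  fixes c :: "nat \<Rightarrow> 'a"
  shows "(\<forall>z\<in>Y_pts N. (\<Sum>i<N. c i * z ^ i) \<in> GF q) \<longleftrightarrow> (\<forall>i<N. c (zmul N q i) = c i ^ q)"
proof -
  \<comment> \<open>The coefficient at j of f - f^q as a function on Y_N: the q-th power moves the
    coefficient at i to the exponent q i, and q^(s-1) j is the index i with q i = j.\<close>
  let ?e = "\<lambda>j. c j - c (zmul N (q ^ (s - 1)) j) ^ q"
  have eq: "(\<Sum>i<N. c i * z ^ i) - (\<Sum>i<N. c i * z ^ i) ^ q = (\<Sum>i<N. ?e i * z ^ i)"
    if z: "z \<in> Y_pts N" for z :: 'a
  proof -
    have "(\<Sum>i<N. c i * z ^ i) ^ q = (\<Sum>i<N. c i ^ q * z ^ (q * i))"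
      using frob_sum[of "\<lambda>i. c i * z ^ i" "{..<N}" 1]
      by (simp add: power_mult_distrib mult.commute[of q] power_mult)
    also have "\<dots> = (\<Sum>i<N. c i ^ q * z ^ zmul N q i)"
      by (simp add: Y_power_zmul z)
    also have "\<dots> = (\<Sum>j<N. c (zmul N (q ^ (s - 1)) j) ^ q * z ^ j)"
      by (rule sum.reindex_bij_witness[of _ "zmul N (q ^ (s - 1))" "zmul N q"])
        (auto simp: zmul_inverse zmul_less[OF N] simp del: One_nat_def)
    finally show ?thesis by (simp add: sum_subtractf left_diff_distrib)
  qed
  have "(\<forall>z\<in>Y_pts N. (\<Sum>i<N. c i * z ^ i) \<in> GF q) \<longleftrightarrow> (\<forall>z\<in>Y_pts N. (\<Sum>i<N. ?e i * z ^ i) = 0)"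
  proof (rule ball_cong[OF refl])
    fix z :: 'a assume z: "z \<in> Y_pts N"
    show "(\<Sum>i<N. c i * z ^ i) \<in> GF q \<longleftrightarrow> (\<Sum>i<N. ?e i * z ^ i) = 0"
      unfolding eq[OF z, symmetric] by (auto simp: GF_def)
  qed
  also have "\<dots> \<longleftrightarrow> (\<forall>j<N. ?e j = 0)"
  proof (intro iffI allI impI ballI)
    fix j assume "\<forall>z\<in>Y_pts N. (\<Sum>i<N. ?e i * z ^ i) = 0" "j < N"
    thus "?e j = 0" by (intro poly_fun_eq_0[of ?e]) blast+
  next
    fix z :: 'a assume "\<forall>j<N. ?e j = 0"
    thus "(\<Sum>i<N. ?e i * z ^ i) = 0" by (intro sum.neutral) simp
  qed
  also have "\<dots> \<longleftrightarrow> (\<forall>i<N. c (zmul N q i) = c i ^ q)"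
  proof (intro iffI allI impI)
    fix i assume "\<forall>j<N. ?e j = 0" "i < N"
    moreover from this(1) have "?e (zmul N q i) = 0"
      using zmul_less[OF N, of q i] by blast
    ultimately show "c (zmul N q i) = c i ^ q" using zmul_inverse by (simp del: One_nat_def)
  next
    fix j assume "\<forall>i<N. c (zmul N q i) = c i ^ q" "j < N"
    moreover from this(1) have "c (zmul N q (zmul N (q ^ (s - 1)) j)) = c (zmul N (q ^ (s - 1)) j) ^ q"
      using zmul_less[OF N, of "q ^ (s - 1)" j] by blast
    ultimately show "?e j = 0" using zmul_inverse by (simp del: One_nat_def)
  qed
  finally show ?thesis .
qed

section \<open>Codewords and their coefficients\<close>

text \<open>The codeword of the form of degree \<open>d\<close> with coefficients \<open>c\<close>.
  Both the monomial generators of the code and the homogenized traces are brought to this form, so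
  that codewords can be compared through coefficient functions.\<close>

definition word :: "nat \<Rightarrow> (nat \<Rightarrow> 'a) \<Rightarrow> 'a \<times> 'a \<Rightarrow> 'a" where
  "word d c = (\<lambda>P. if P \<in> X_pts N then \<Sum>i\<le>d. c i * fst P ^ (d - i) * snd P ^ i else 0)"

lemma ev_bmonom:
  "ev N (bmonom (1::'a) i j) = (\<lambda>P. if P \<in> X_pts N then fst P ^ i * snd P ^ j else 0)"
  by (auto simp: ev_def fun_eq_iff bpoly_bmonom)

lemma ev_homogenize: "ev N (homogenize d g) = word d (coeff g)"
proof -
  have "bpoly (homogenize d g) P = (\<Sum>i\<le>d. coeff g i * fst P ^ (d - i) * snd P ^ i)" for P
    by (cases P) (simp add: homogenize_def bpoly_def poly_sum bmonom_def poly_monom poly_power)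
  thus ?thesis by (simp add: ev_def word_def fun_eq_iff)
qed

lemma word_affine:
  assumes "z \<in> Y_pts N" "d < N" "\<And>i. i > d \<Longrightarrow> c i = 0"
  shows "word d c (1, z) = (\<Sum>i<N. c i * z ^ i)"
proof -
  have "word d c (1, z) = (\<Sum>i\<le>d. c i * z ^ i)"
    using assms by (simp add: word_def X_pts_def)
  also have "\<dots> = (\<Sum>i<N. c i * z ^ i)"
    using assms by (intro sum.mono_neutral_left) (auto simp: not_le)
  finally show ?thesis .
qed

text \<open>At x_0 = 0 every term with i < d vanishes, while the term i = d survives since 0^0 =
  1.\<close>

lemma word_infinity: "word d c (0, 1) = c d"
proof -
  have "c i * 0 ^ (d - i) = (if i = d then c i else 0)" if "i \<le> d" for i
    using that by (simp add: power_0_left)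
  hence "(\<Sum>i\<le>d. c i * 0 ^ (d - i)) = (\<Sum>i\<le>d. if i = d then c i else 0)"
    by (intro sum.cong) auto
  thus ?thesis by (simp add: word_def X_pts_def)
qed

lemma word_eq_0:
  assumes "d < N" "\<And>i. i > d \<Longrightarrow> c i = 0" "\<And>P. word d c P = 0"
  shows "c i = 0"
proof (cases "i < N")
  case True
  show ?thesis
  proof (rule poly_fun_eq_0[OF _ True])
    fix z :: 'a assume "z \<in> Y_pts N"
    thus "(\<Sum>i<N. c i * z ^ i) = 0" using word_affine[of z d c] assms by simp
  qed
next
  case False thus ?thesis using assms by simp
qed

lemma word_sum: "word d (\<lambda>i. \<Sum>j\<in>J. m j * c j i) P = (\<Sum>j\<in>J. m j * word d (c j) P)"
proof -
  have "(\<Sum>i\<le>d. (\<Sum>j\<in>J. m j * c j i) * fst P ^ (d - i) * snd P ^ i) =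
    (\<Sum>i\<le>d. \<Sum>j\<in>J. m j * (c j i * fst P ^ (d - i) * snd P ^ i))"
    by (simp add: sum_distrib_right mult.assoc)
  also have "\<dots> = (\<Sum>j\<in>J. \<Sum>i\<le>d. m j * (c j i * fst P ^ (d - i) * snd P ^ i))"
    by (rule sum.swap)
  finally show ?thesis by (simp add: word_def sum_distrib_left)
qed

text \<open>\<open>lin_span\<close> sums over a set of vectors. Independence of the evaluated
  monomials, over the whole field, allows this sum to be indexed by \<Delta> instead.\<close>

lemma PRS_eq:
  assumes "finite \<Delta>" "Max \<Delta> < N"
  shows "PRS N \<Delta> = {word (Max \<Delta>) c | c. \<forall>i. i \<notin> \<Delta> \<longrightarrow> c i = 0}"
proof -
  define d where "d = Max \<Delta>"
  let ?v = "\<lambda>i. ev N (bmonom (1::'a) (d - i) i)"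
  have le: "i \<le> d" if "i \<in> \<Delta>" for i using assms that by (simp add: d_def)
  have sum: "(\<lambda>P. \<Sum>i\<in>\<Delta>. c i * ?v i P) = word d (\<lambda>i. if i \<in> \<Delta> then c i else 0)" for c
  proof
    fix P
    have "(\<Sum>i\<in>\<Delta>. c i * (fst P ^ (d - i) * snd P ^ i)) =
      (\<Sum>i\<le>d. (if i \<in> \<Delta> then c i else 0) * fst P ^ (d - i) * snd P ^ i)"
      using le by (intro sum.mono_neutral_cong_left) (auto simp: mult.assoc)
    thus "(\<Sum>i\<in>\<Delta>. c i * ?v i P) = word d (\<lambda>i. if i \<in> \<Delta> then c i else 0) P"
      by (simp add: ev_bmonom word_def)
  qed
  have "is_basis UNIV (?v ` \<Delta>) {word d c | c. \<forall>i. i \<notin> \<Delta> \<longrightarrow> c i = 0}"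
  proof (rule is_basis_image[OF is_subfield_UNIV assms(1)])
    fix c i assume c: "\<And>P. (\<Sum>i\<in>\<Delta>. c i * ?v i P) = 0" and i: "i \<in> \<Delta>"
    have "(if i \<in> \<Delta> then c i else 0) = 0"
    proof (rule word_eq_0[of d "\<lambda>i. if i \<in> \<Delta> then c i else 0"])
      show "word d (\<lambda>i. if i \<in> \<Delta> then c i else 0) P = 0" for P
        using c[of P] fun_cong[OF sum, of c P] by simp
    qed (use assms(2) le[THEN leD] in \<open>auto simp: d_def\<close>)
    thus "c i = 0" using i by simp
  next
    show "{word d c | c. \<forall>i. i \<notin> \<Delta> \<longrightarrow> c i = 0} =
      {\<lambda>P. \<Sum>i\<in>\<Delta>. c i * ?v i P | c. \<forall>i\<in>\<Delta>. c i \<in> UNIV}"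
    proof (intro equalityI subsetI)
      fix w assume "w \<in> {word d c | c. \<forall>i. i \<notin> \<Delta> \<longrightarrow> c i = 0}"
      then obtain c where c: "w = word d c" "\<forall>i. i \<notin> \<Delta> \<longrightarrow> c i = 0" by blast
      hence "c = (\<lambda>i. if i \<in> \<Delta> then c i else 0)" by auto
      hence "w = (\<lambda>P. \<Sum>i\<in>\<Delta>. c i * ?v i P)" unfolding sum using c by simp
      thus "w \<in> {\<lambda>P. \<Sum>i\<in>\<Delta>. c i * ?v i P | c. \<forall>i\<in>\<Delta>. c i \<in> UNIV}" by blast
    qed (use sum in auto)
  qed
  moreover have "{?v i | i. i \<in> \<Delta>} = ?v ` \<Delta>" by blast
  ultimately show ?thesis by (simp add: PRS_def is_basis_def d_def)
qed

lemma PRS_sub_eq: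
  assumes "finite \<Delta>" "Max \<Delta> < N"
  shows "PRS_sub q N \<Delta> = {word (Max \<Delta>) c | c. (\<forall>i. i \<notin> \<Delta> \<longrightarrow> c i = 0) \<and>
    (\<forall>i<N. c (zmul N q i) = c i ^ q) \<and> c (Max \<Delta>) \<in> GF q}"
proof -
  have "(\<forall>P\<in>X_pts N. word (Max \<Delta>) c P \<in> GF q) \<longleftrightarrow>
    (\<forall>i<N. c (zmul N q i) = c i ^ q) \<and> c (Max \<Delta>) \<in> GF q"
    if c: "\<forall>i. i \<notin> \<Delta> \<longrightarrow> c i = 0" for c :: "nat \<Rightarrow> 'a"
  proof -
    have 0: "c i = 0" if "i > Max \<Delta>" for i
      using c that assms(1) Max_ge[of \<Delta> i] by (metis not_le)
    have "(\<forall>P\<in>X_pts N. word (Max \<Delta>) c P \<in> GF q) \<longleftrightarrow>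
      (\<forall>z\<in>Y_pts N. word (Max \<Delta>) c (1, z) \<in> GF q) \<and> word (Max \<Delta>) c (0, 1) \<in> GF q"
      unfolding X_pts_def by auto
    also have "\<dots> \<longleftrightarrow> (\<forall>z\<in>Y_pts N. (\<Sum>i<N. c i * z ^ i) \<in> GF q) \<and> c (Max \<Delta>) \<in> GF q"
      using assms(2) 0 by (simp add: word_affine word_infinity)
    finally show ?thesis by (simp add: poly_fun_subfield_iff)
  qed
  thus ?thesis unfolding PRS_sub_def PRS_eq[OF assms] by blast
qed

section \<open>Trace polynomials\<close>

text \<open>Subtracting the multiple x^(e-1) (x^N - x) lowers the exponent e + N - 1 to e. This
  needs e > 0, whence the side condition: x^(N-1) does not reduce to x^0.\<close>

lemma monom_mod:
  assumes "j \<le> N - 1" "j > 0 \<or> k = 0"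
  shows "monom (c::'a) (j + k * (N - 1)) mod (monom 1 N - monom 1 1) = monom c j"
  using assms(2)
proof (induction k)
  case 0
  let ?g = "monom 1 N - monom 1 1 :: 'a poly"
  have "coeff ?g N = 1" using N by simp
  hence "N \<le> degree ?g" by (intro le_degree) simp
  hence "degree (monom c j) < degree ?g" using assms(1) N degree_monom_le[of c j] by linarith
  thus ?case by (simp add: mod_poly_less)
next
  case (Suc k)
  let ?g = "monom 1 N - monom 1 1 :: 'a poly"
  let ?e = "j + k * (N - 1)"
  from Suc have j: "j > 0" by simp
  have "?e - 1 + N = j + Suc k * (N - 1)" "?e - 1 + 1 = ?e" using j N by simp_all
  hence "monom c (?e - 1) * ?g = monom c (j + Suc k * (N - 1)) - monom c ?e"
    unfolding right_diff_distrib mult_monom by simp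
  hence "monom c (j + Suc k * (N - 1)) = monom c ?e + monom c (?e - 1) * ?g" by simp
  hence "monom c (j + Suc k * (N - 1)) mod ?g = monom c ?e mod ?g" by simp
  thus ?case using Suc j by simp
qed

lemma monom_mod_zmul:
  assumes "a > 0"
  shows "monom (c::'a) (a * b) mod (monom 1 N - monom 1 1) = monom c (zmul N a b)"
proof (cases "b = 0")
  case True
  thus ?thesis using monom_mod[of 0 0 c] by simp
next
  case False
  \<comment> \<open>Dividing \<open>a * b - 1\<close> rather than \<open>a * b\<close> by N - 1
    leaves a representative in {1,...,N-1}.\<close>
  have "a * b = zmul N a b + (a * b - 1) div (N - 1) * (N - 1)"
  proof -
    have "a * b > 0" using assms False by simp
    thus ?thesis
      using False mod_div_mult_eq[of "a * b - 1" "N - 1"] unfolding zmul_def by simp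
  qed
  thus ?thesis
    using monom_mod[of "zmul N a b" "(a * b - 1) div (N - 1)" c] zmul_less[OF N, of a b] False by simp
qed

lemma poly_mod_sum: "(\<Sum>i\<in>A. f i) mod (g :: 'a poly) = (\<Sum>i\<in>A. f i mod g)"
  by (induction A rule: infinite_finite_induct) (auto simp: poly_mod_add_left)

lemma coeff_trace_poly:
  "coeff (trace_poly q N b (monom (a::'a) b)) j =
    (\<Sum>k<cyc_card q N b. if zmul N (q ^ k) b = j then a ^ (q ^ k) else 0)"
  unfolding trace_poly_def poly_mod_sum coeff_sum
  by (simp add: monom_power mult.commute[of b] monom_mod_zmul del: One_nat_def)

lemma coeff_trace_poly_outside:
  assumes "j \<notin> cyc q N b"
  shows "coeff (trace_poly q N b (monom (a::'a) b)) j = 0"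
  unfolding coeff_trace_poly using assms by (intro sum.neutral) (auto simp: cyc_def)

lemma coeff_trace_poly_orbit:
  assumes "b < N" "k < cyc_card q N b"
  shows "coeff (trace_poly q N b (monom (a::'a) b)) (zmul N (q ^ k) b) = a ^ (q ^ k)"
proof -
  have "(\<Sum>l<cyc_card q N b. if zmul N (q ^ l) b = zmul N (q ^ k) b then a ^ (q ^ l) else 0)
      = (\<Sum>l<cyc_card q N b. if l = k then a ^ (q ^ l) else 0)"
    using inj_onD[OF zmul_orbit(3)[OF assms(1)]] assms(2) by (intro sum.cong) auto
  thus ?thesis using assms(2) by (simp add: coeff_trace_poly)
qed

lemma coeff_trace_poly_self:
  assumes "b < N"
  shows "coeff (trace_poly q N b (monom (a::'a) b)) b = a"
  using coeff_trace_poly_orbit[of b 0 a] zmul_orbit(1) assms by (simp add: zmul_1[simplified])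

text \<open>Along the orbit of b the coefficients are a, a^q, a^(q^2), ..., so one step of the orbit
  is one Frobenius step. The wrap from the last index back to b is consistent because a^(q^{n_b}) =
  a.\<close>

lemma coeff_trace_poly_zmul:
  assumes "b < N" "i < N" "(a::'a) \<in> GF (q ^ cyc_card q N b)"
  shows "coeff (trace_poly q N b (monom a b)) (zmul N q i) =
    coeff (trace_poly q N b (monom a b)) i ^ q"
proof (cases "i \<in> cyc q N b")
  case True
  then obtain k where k: "k < cyc_card q N b" "i = zmul N (q ^ k) b"
    using zmul_orbit(4)[OF assms(1)] by force
  have i: "zmul N q i = zmul N (q ^ Suc k) b" using k(2) zmul_power[of 1 k b] by simp
  show ?thesis
  proof (cases "Suc k < cyc_card q N b")
    case True
    thus ?thesis unfolding i coeff_trace_poly_orbit[OF assms(1) True]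
      unfolding k(2) coeff_trace_poly_orbit[OF assms(1) k(1)]
      by (simp add: mult.commute flip: power_mult)
  next
    case False
    hence n: "cyc_card q N b = Suc k" using k by simp
    have "zmul N q i = b" unfolding i using zmul_orbit(2)[OF assms(1)] n by simp
    moreover have "a ^ (q ^ Suc k) = a" using assms(3) n by (simp add: GF_def)
    ultimately show ?thesis
      unfolding k(2) coeff_trace_poly_orbit[OF assms(1) k(1)]
      using coeff_trace_poly_self[OF assms(1), of a] by (simp add: k(2) mult.commute flip: power_mult)
  qed
next
  case False
  have "zmul N q i \<notin> cyc q N b"
  proof
    assume "zmul N q i \<in> cyc q N b"
    hence "zmul N (q ^ (s - 1)) (zmul N q i) \<in> cyc q N b"
      by (rule cyc_zmul)
    thus False using False zmul_inverse(1)[OF assms(2)] by simp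
  qed
  thus ?thesis using False by (simp add: coeff_trace_poly_outside power_0_left)
qed

text \<open>The rigidity of a cyclotomic set: its coefficients are determined by the one at b, a
  single zero forces all of them to vanish, and one full turn puts the coefficient at b into
  F_{q^{n_b}}.\<close>

lemma coeff_orbit:
  fixes c :: "nat \<Rightarrow> 'a"
  assumes "\<forall>i<N. c (zmul N q i) = c i ^ q" "b < N"
  shows "c (zmul N (q ^ k) b) = c b ^ (q ^ k)"
proof (induction k)
  case (Suc k)
  have "c (zmul N (q ^ Suc k) b) = c (zmul N q (zmul N (q ^ k) b))"
    using zmul_power[of 1 k b] by simp
  also have "\<dots> = c (zmul N (q ^ k) b) ^ q"
    using assms(1) zmul_less[OF N, of "q ^ k" b] by blast
  finally show ?case using Suc by (simp add: mult.commute flip: power_mult)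
qed (use assms in \<open>simp add: zmul_1[simplified]\<close>)

text \<open>
  The case distinction of the theorem only affects the fibre over \<open>d\<close>: the coordinate at \<open>(0,1)\<close>
  forces the coefficient at \<open>d\<close> into \<open>GF q\<close>, so a basis of \<open>GF q\<close> over itself replaces one of
  \<open>GF (q\<^sup>n)\<close>.
\<close>

lemma trace_basis:
  fixes \<Delta> :: "nat set" and e :: "nat \<Rightarrow> nat \<Rightarrow> 'a"
  assumes \<Delta>: "finite \<Delta>" "Max \<Delta> < N"
  defines "d \<equiv> Max \<Delta>" and "B \<equiv> {b \<in> max_reps q N. cyc q N b \<subseteq> \<Delta>}"
  defines "K \<equiv> \<lambda>b. if b = d then GF q else GF (q ^ cyc_card q N b)"
  assumes R: "\<And>b. b \<in> B \<Longrightarrow> finite (R b)"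
    and e: "\<And>b r. b \<in> B \<Longrightarrow> r \<in> R b \<Longrightarrow> e b r \<in> K b"
    and indep: "\<And>b c r. \<lbrakk>b \<in> B; \<And>r. r \<in> R b \<Longrightarrow> c r \<in> GF q; (\<Sum>r\<in>R b. c r * e b r) = 0; r \<in> R b\<rbrakk>
      \<Longrightarrow> c r = 0"
    and span: "\<And>b x. \<lbrakk>b \<in> B; x \<in> K b\<rbrakk> \<Longrightarrow> \<exists>c. (\<forall>r\<in>R b. c r \<in> GF q) \<and> x = (\<Sum>r\<in>R b. c r * e b r)"
  shows "is_basis (GF q) ((\<lambda>(b, r). ev N (hom_trace q N d b (monom (e b r) b))) ` Sigma B R)
    (PRS_sub q N \<Delta>)"
proof -
  define t where "t = (\<lambda>(b, r). coeff (trace_poly q N b (monom (e b r) b)))"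
  have v: "(\<lambda>(b, r). ev N (hom_trace q N d b (monom (e b r) b))) = (\<lambda>p. word d (t p))"
    by (auto simp: fun_eq_iff hom_trace_def ev_homogenize t_def)
  have d: "d < N" using \<Delta> by (simp add: d_def)
  have B: "b < N" "Max (cyc q N b) = b" "cyc q N b \<subseteq> \<Delta>" if "b \<in> B" for b
    using that max_reps_iff by (auto simp: B_def)
  have finB: "finite B" by (rule finite_subset[of _ "{..<N}"]) (auto intro: B(1))
  have finJ: "finite (Sigma B R)" using finB R by auto
  have big: "c i = 0" if "\<forall>i. i \<notin> \<Delta> \<longrightarrow> c i = 0" "i > d" for c :: "nat \<Rightarrow> 'a" and i
    using that \<Delta>(1) Max_ge[of \<Delta> i] by (metis not_le d_def)
  have K: "K b \<subseteq> GF (q ^ cyc_card q N b)" for b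
    using GF_q_subset by (auto simp: K_def)
  \<comment> \<open>Only the fibre over \<open>d\<close> itself can contribute to the coefficient at
    \<open>d\<close>, hence to the entry at (0,1).\<close>
  have at_d: "b = d" if "b \<in> B" "d \<in> cyc q N b" for b
  proof -
    have "b \<in> \<Delta>" using B[OF that(1)] cyc_self by blast
    hence "b \<le> d" using \<Delta> by (simp add: d_def)
    moreover have "d \<le> b" using B(2)[OF that(1)] that(2) Max_ge[of "cyc q N b" d] by simp
    ultimately show ?thesis by simp
  qed
  have t_out: "t (b, r) i = 0" if "i \<notin> cyc q N b" for b r i
    using that by (simp add: t_def coeff_trace_poly_outside)
  have t_self: "t (b, r) b = e b r" if "b \<in> B" for b r
    using B(1)[OF that] by (simp add: t_def coeff_trace_poly_self)
  define comb where "comb l i = (\<Sum>p\<in>Sigma B R. l p * t p i)" for l i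
  have comb_word: "(\<lambda>P. \<Sum>p\<in>Sigma B R. l p * word d (t p) P) = word d (comb l)" for l
    unfolding comb_def[abs_def] by (rule ext) (rule word_sum[symmetric])
  have comb_out: "\<forall>i. i \<notin> \<Delta> \<longrightarrow> comb l i = 0" for l
    unfolding comb_def
  proof (intro allI impI sum.neutral ballI)
    fix i p assume i: "i \<notin> \<Delta>" and "p \<in> Sigma B R"
    then obtain b r where "p = (b, r)" "b \<in> B" by auto
    moreover from this(2) have "i \<notin> cyc q N b" using B(3) i by blast
    ultimately show "l p * t p i = 0" using t_out by simp
  qed
  \<comment> \<open>Distinct maximal representatives have disjoint cyclotomic sets, so reading the
    coefficient at \<open>b\<close> isolates one fibre. This reduces independence and spanning to
    each fibre separately.\<close>
  have comb_at: "comb l b = (\<Sum>r\<in>R b. l (b, r) * e b r)" if b: "b \<in> B" for l b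
  proof -
    have "comb l b = (\<Sum>b'\<in>B. \<Sum>r\<in>R b'. l (b', r) * t (b', r) b)"
      unfolding comb_def using finB R by (subst sum.Sigma) auto
    also have "\<dots> = (\<Sum>b'\<in>{b}. \<Sum>r\<in>R b'. l (b', r) * t (b', r) b)"
    proof (intro sum.mono_neutral_right ballI finB)
      fix b' assume b': "b' \<in> B - {b}"
      hence "b \<notin> cyc q N b'"
        using max_reps_unique[of b b' b] b cyc_self[OF B(1)[OF b]] unfolding B_def by blast
      thus "(\<Sum>r\<in>R b'. l (b', r) * t (b', r) b) = 0" by (simp add: t_out)
    qed (use b in auto)
    finally show ?thesis using b by (simp add: t_self)
  qed
  have comb_frob: "comb l (zmul N q i) = comb l i ^ q"
    if l: "\<forall>p\<in>Sigma B R. l p \<in> GF q" and i: "i < N" for l i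
  proof -
    have "comb l i ^ q = (\<Sum>p\<in>Sigma B R. (l p * t p i) ^ q)"
      unfolding comb_def using frob_sum[of _ _ 1] by simp
    also have "\<dots> = comb l (zmul N q i)"
      unfolding comb_def
    proof (intro sum.cong refl)
      fix p assume p: "p \<in> Sigma B R"
      then obtain b r where br: "p = (b, r)" "b \<in> B" "r \<in> R b" by auto
      have "e b r \<in> GF (q ^ cyc_card q N b)" using e[OF br(2,3)] K by auto
      hence "t p (zmul N q i) = t p i ^ q"
        using coeff_trace_poly_zmul[OF B(1)[OF br(2)] i] by (simp add: t_def br)
      moreover have "l p ^ q = l p" using l p by (auto simp: GF_def)
      ultimately show "(l p * t p i) ^ q = l p * t p (zmul N q i)"
        by (simp add: power_mult_distrib)
    qed
    finally show ?thesis by simp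
  qed
  have comb_d: "comb l d \<in> GF q" if l: "\<forall>p\<in>Sigma B R. l p \<in> GF q" for l
    unfolding comb_def
  proof (intro is_subfield_sum[OF GF_q_subfield] is_subfield_mult[OF GF_q_subfield])
    fix p assume p: "p \<in> Sigma B R"
    thus "l p \<in> GF q" using l by blast
    obtain b r where br: "p = (b, r)" "b \<in> B" "r \<in> R b" using p by auto
    show "t p d \<in> GF q"
    proof (cases "d \<in> cyc q N b")
      case True
      hence "b = d" using at_d br by blast
      thus ?thesis using e[OF br(2,3)] t_self br by (simp add: K_def)
    next
      case False
      thus ?thesis using t_out br GF_q_subfield by (simp add: is_subfield_def)
    qed
  qed
  show ?thesis unfolding v
  proof (rule is_basis_image[OF GF_q_subfield finJ])
    fix l p
    assume l: "\<And>p. p \<in> Sigma B R \<Longrightarrow> l p \<in> GF q"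
      and 0: "\<And>P. (\<Sum>p\<in>Sigma B R. l p * word d (t p) P) = 0" and p: "p \<in> Sigma B R"
    obtain b r where br: "p = (b, r)" "b \<in> B" "r \<in> R b" using p by auto
    have "word d (comb l) P = 0" for P
      using 0[of P] fun_cong[OF comb_word, of l P] by simp
    hence "comb l b = 0" using word_eq_0[of d "comb l" b] d big comb_out by blast
    hence "(\<Sum>r\<in>R b. l (b, r) * e b r) = 0" using comb_at br by simp
    thus "l p = 0" using indep[of b "\<lambda>r. l (b, r)" r] br l by auto
  next
    show "PRS_sub q N \<Delta> = {\<lambda>P. \<Sum>p\<in>Sigma B R. l p * word d (t p) P | l. \<forall>p\<in>Sigma B R. l p \<in> GF q}"
      (is "_ = ?V")
    proof (intro equalityI subsetI)
      fix w assume "w \<in> ?V"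
      then obtain l where l: "w = word d (comb l)" "\<forall>p\<in>Sigma B R. l p \<in> GF q"
        using comb_word by auto
      thus "w \<in> PRS_sub q N \<Delta>"
        unfolding PRS_sub_eq[OF \<Delta>, folded d_def] using comb_out comb_frob comb_d by blast
    next
      fix w :: "'a \<times> 'a \<Rightarrow> 'a" assume "w \<in> PRS_sub q N \<Delta>"
      then obtain c where w: "w = word d c" and out: "\<forall>i. i \<notin> \<Delta> \<longrightarrow> c i = 0"
        and frob: "\<forall>i<N. c (zmul N q i) = c i ^ q" and cd: "c d \<in> GF q"
        unfolding PRS_sub_eq[OF \<Delta>, folded d_def] by blast
      \<comment> \<open>For \<open>b \<noteq> d\<close> this is one full turn of the orbit; for
        \<open>b = d\<close> it is the condition \<open>cd\<close> coming from (0,1).\<close>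
      have "c b \<in> K b" if "b \<in> B" for b
        using coeff_orbit[OF frob B(1)[OF that], of "cyc_card q N b"] zmul_orbit(2)[OF B(1)[OF that]] cd
        by (auto simp: K_def GF_def)
      hence "\<forall>b\<in>B. \<exists>m. (\<forall>r\<in>R b. m r \<in> GF q) \<and> c b = (\<Sum>r\<in>R b. m r * e b r)"
        using span by blast
      then obtain m where m: "\<And>b. b \<in> B \<Longrightarrow> (\<forall>r\<in>R b. m b r \<in> GF q) \<and> c b = (\<Sum>r\<in>R b. m b r * e b r)"
        by metis
      \<comment> \<open>The scalars are chosen to match \<open>c\<close> at the representatives in
        \<open>B\<close>; the Frobenius relation, shared by \<open>c\<close> and
        \<open>comb l\<close>, then extends the agreement to all indices.\<close>
      define l where "l = (\<lambda>(b, r). m b r)"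
      have l: "\<forall>p\<in>Sigma B R. l p \<in> GF q" using m by (auto simp: l_def)
      have eq: "comb l b = c b" if "b \<in> B" for b
        using comb_at[OF that] m[OF that] by (simp add: l_def)
      have "comb l i = c i" for i
      proof (cases "i \<in> \<Delta>")
        case True
        have "i < N" using True \<Delta> Max_ge[of \<Delta> i] by linarith
        then obtain b where b: "b \<in> max_reps q N" "i \<in> cyc q N b" "cyc q N b = cyc q N i"
          by (rule max_reps_exists)
        have bN: "b < N" using b(1) max_reps_iff by blast
        obtain k where k: "i = zmul N (q ^ k) b" using b(2) by (auto simp: cyc_def)
        have frob': "\<forall>i<N. comb l (zmul N q i) = comb l i ^ q" using comb_frob[OF l] by blast
        have "comb l b = c b"
        proof (cases "b \<in> B")
          case True thus ?thesis by (rule eq)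
        next
          case False
          \<comment> \<open>Both coefficient functions vanish at an index \<open>j\<close> outside
            \<Delta>, and the value at \<open>j\<close> is a Frobenius power of the value at
            \<open>b\<close>, so both vanish at \<open>b\<close>.\<close>
          then obtain j where j: "j \<in> cyc q N b" "j \<notin> \<Delta>" using b(1) by (auto simp: B_def)
          obtain k where k: "j = zmul N (q ^ k) b" using j(1) by (auto simp: cyc_def)
          have "comb l j = 0" "c j = 0" using comb_out out j(2) by auto
          thus ?thesis
            using coeff_orbit[OF frob' bN, of k] coeff_orbit[OF frob bN, of k] k by simp
        qed
        thus ?thesis
          using coeff_orbit[OF frob' bN, of k] coeff_orbit[OF frob bN, of k] k by simp
      next
        case False thus ?thesis using comb_out out by simp
      qed
      hence "w = word d (comb l)" using w by presburger
      hence "w = (\<lambda>P. \<Sum>p\<in>Sigma B R. l p * word d (t p) P)" unfolding comb_word .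
      thus "w \<in> ?V" using l by blast
    qed
  qed
qed

end

section \<open>Choice of a basis in each fibre, and the two cases\<close>

theorem theorem3p4:
  fixes q s N d :: nat and \<Delta> :: "nat set" and \<xi> :: "nat \<Rightarrow> 'a::finite_field"
  assumes "primepow q" and "s \<ge> 1" and "CARD('a) = q ^ s"
    and "N > 1" and "N - 1 dvd q ^ s - 1"
    and "\<Delta> \<noteq> {}" and "\<Delta> \<subseteq> {0..N - 1}" and "0 \<in> \<Delta>" and "d = Max \<Delta>"
    and "\<forall>b\<in>max_reps q N. primitive_element (GF (q ^ cyc_card q N b)) (\<xi> b)"
  shows
    "(cyc q N d \<subseteq> \<Delta> \<longrightarrow>
        is_basis (GF q)
          (ev N `
            ((\<Union>b\<in>{b \<in> max_reps q N. cyc q N b \<subseteq> \<Delta> \<and> b < d}.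
                {hom_trace q N d b (monom (\<xi> b ^ r) b) | r. 0 \<le> r \<and> r \<le> cyc_card q N b - 1})
             \<union> {hom_trace q N d d (monom 1 d)}))
          (PRS_sub q N \<Delta>)) \<and>
     (\<not> cyc q N d \<subseteq> \<Delta> \<longrightarrow>
        is_basis (GF q)
          (ev N `
            (\<Union>b\<in>{b \<in> max_reps q N. cyc q N b \<subseteq> \<Delta>}.
                {hom_trace q N d b (monom (\<xi> b ^ r) b) | r. 0 \<le> r \<and> r \<le> cyc_card q N b - 1}))
          (PRS_sub q N \<Delta>))"
proof -
  interpret cyclotomic_code q s N "TYPE('a)"
    using assms by unfold_locales auto
  define B where "B = {b \<in> max_reps q N. cyc q N b \<subseteq> \<Delta>}"
  \<comment> \<open>Over \<open>d\<close> the space is GF q, with basis 1 = \<xi>_d^0; this is the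
    single polynomial T_d^h(x_1^d) of the first case.\<close>
  define R where "R b = (if b = d then {0} else {..<cyc_card q N b})" for b
  let ?v = "\<lambda>(b, r). ev N (hom_trace q N d b (monom (\<xi> b ^ r) b))"
  have fin: "finite \<Delta>" using assms(7) by (rule finite_subset) simp
  have dN: "d < N" using Max_in[OF fin assms(6)] assms by auto
  have B: "b < N" "Max (cyc q N b) = b" "cyc q N b \<subseteq> \<Delta>" "b \<le> d" if "b \<in> B" for b
  proof -
    show *: "b < N" "Max (cyc q N b) = b" "cyc q N b \<subseteq> \<Delta>"
      using that max_reps_iff by (auto simp: B_def)
    show "b \<le> d" using * cyc_self[of b] fin assms(9) by auto
  qed
  have prim: "primitive_element (GF (q ^ cyc_card q N b)) (\<xi> b)" if "b \<in> B" for b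
    using assms(10) that by (auto simp: B_def)
  have card: "card (GF (q ^ cyc_card q N b) :: 'a set) = card (GF q :: 'a set) ^ cyc_card q N b"
    if "b \<in> B" for b
    using card_GF[OF assms(3,1) zmul_orbit(5)[OF B(1)[OF that]] assms(2)]
      card_GF[OF assms(3,1), of 1] assms(2) by simp
  have basis: "is_basis (GF q) (?v ` Sigma B R) (PRS_sub q N \<Delta>)"
    unfolding B_def assms(9)
  proof (rule trace_basis[where e = "\<lambda>b r. \<xi> b ^ r"], unfold B_def[symmetric] assms(9)[symmetric])
    show "\<xi> b ^ r \<in> (if b = d then GF q else GF (q ^ cyc_card q N b))"
      if "b \<in> B" "r \<in> R b" for b r
      using that prim[OF that(1)] by (auto simp: R_def primitive_element_def GF_def)
  next
    fix b c r
    assume b: "b \<in> B" and c: "\<And>r. r \<in> R b \<Longrightarrow> c r \<in> GF q" "(\<Sum>r\<in>R b. c r * \<xi> b ^ r) = 0" and r: "r \<in> R b"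
    show "c r = 0"
    proof (cases "b = d")
      case True thus ?thesis using c r by (simp add: R_def)
    next
      case False
      hence R: "R b = {..<cyc_card q N b}" by (simp add: R_def)
      show ?thesis
        by (rule primitive_powers_indep[OF GF_q_subfield GF_subfield card[OF b] prim[OF b]])
          (use c r in \<open>simp_all add: R\<close>)
    qed
  next
    fix b and x :: 'a assume b: "b \<in> B" and x: "x \<in> (if b = d then GF q else GF (q ^ cyc_card q N b))"
    show "\<exists>c. (\<forall>r\<in>R b. c r \<in> GF q) \<and> x = (\<Sum>r\<in>R b. c r * \<xi> b ^ r)"
    proof (cases "b = d")
      case True thus ?thesis using x by (intro exI[of _ "\<lambda>_. x"]) (simp add: R_def)
    next
      case False
      with x have "x \<in> GF (q ^ cyc_card q N b)" by simp
      hence "\<exists>c. (\<forall>r<cyc_card q N b. c r \<in> GF q) \<and> x = (\<Sum>r<cyc_card q N b. c r * \<xi> b ^ r)"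
        by (rule primitive_powers_span[OF GF_q_subfield GF_subfield card[OF b] GF_q_subset prim[OF b]])
      with False show ?thesis by (simp add: R_def Ball_def)
    qed
  qed (use fin dN assms(9) in \<open>auto simp: R_def\<close>)
  \<comment> \<open>The truncated subtraction is harmless because n_b > 0.\<close>
  have Rle: "{r. 0 \<le> r \<and> r \<le> cyc_card q N b - 1} = {..<cyc_card q N b}" if "b \<in> B" for b
    using zmul_orbit(1)[OF B(1)[OF that]] by auto
  have fibre: "ev N ` {hom_trace q N d b (monom (\<xi> b ^ r) b) | r. 0 \<le> r \<and> r \<le> cyc_card q N b - 1}
      = (\<lambda>r. ?v (b, r)) ` {..<cyc_card q N b}" if "b \<in> B" for b
    unfolding Rle[OF that, symmetric] by auto
  have image: "?v ` Sigma B R = (\<Union>b\<in>B. (\<lambda>r. ?v (b, r)) ` R b)"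
    by force
  show ?thesis
  proof (intro conjI impI)
    assume d: "cyc q N d \<subseteq> \<Delta>"
    \<comment> \<open>Being the maximum of \<Delta>, \<open>d\<close> is also the maximum of any
      subset of \<Delta> that contains it; hence it is itself a maximal representative.\<close>
    have "Max (cyc q N d) = d"
    proof (rule antisym)
      show "d \<le> Max (cyc q N d)" using cyc_self[OF dN] by simp
      show "Max (cyc q N d) \<le> d"
        unfolding assms(9) using d cyc_self[OF dN] assms(9) by (intro Max_mono fin) auto
    qed
    hence dB: "d \<in> B" using d dN max_reps_iff by (auto simp: B_def)
    let ?B = "{b \<in> max_reps q N. cyc q N b \<subseteq> \<Delta> \<and> b < d}"
    have B': "B = ?B \<union> {d}" using dB B(4) by (fastforce simp: B_def)
    have "?v ` Sigma B R = (\<Union>b\<in>?B. (\<lambda>r. ?v (b, r)) ` {..<cyc_card q N b}) \<union> {?v (d, 0)}"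
      unfolding image unfolding B' UN_Un by (simp add: R_def)
    also have "(\<Union>b\<in>?B. (\<lambda>r. ?v (b, r)) ` {..<cyc_card q N b}) = ev N `
        (\<Union>b\<in>?B. {hom_trace q N d b (monom (\<xi> b ^ r) b) | r. 0 \<le> r \<and> r \<le> cyc_card q N b - 1})"
      unfolding image_UN by (intro SUP_cong refl fibre[symmetric]) (simp add: B_def)
    also have "\<dots> \<union> {?v (d, 0)} = ev N `
        ((\<Union>b\<in>?B. {hom_trace q N d b (monom (\<xi> b ^ r) b) | r. 0 \<le> r \<and> r \<le> cyc_card q N b - 1})
         \<union> {hom_trace q N d d (monom 1 d)})"
      by (simp only: image_Un image_insert image_empty power_0 prod.case)
    finally show "is_basis (GF q) (ev N `
            ((\<Union>b\<in>?B. {hom_trace q N d b (monom (\<xi> b ^ r) b) | r. 0 \<le> r \<and> r \<le> cyc_card q N b - 1})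
             \<union> {hom_trace q N d d (monom 1 d)})) (PRS_sub q N \<Delta>)"
      using basis by (rule subst)
  next
    assume d: "\<not> cyc q N d \<subseteq> \<Delta>"
    \<comment> \<open>No fibre lies over \<open>d\<close> now, so the exceptional value of
      \<open>R\<close> does not occur and every fibre keeps its full power basis.\<close>
    hence "d \<notin> B" by (simp add: B_def)
    hence "?v ` Sigma B R = (\<Union>b\<in>B. (\<lambda>r. ?v (b, r)) ` {..<cyc_card q N b})"
      unfolding image by (intro SUP_cong refl) (auto simp: R_def)
    also have "\<dots> = ev N ` (\<Union>b\<in>B. {hom_trace q N d b (monom (\<xi> b ^ r) b) | r. 0 \<le> r \<and> r \<le> cyc_card q N b - 1})"
      unfolding image_UN by (intro SUP_cong refl fibre[symmetric])
    finally show "is_basis (GF q) (ev N ` (\<Union>b\<in>{b \<in> max_reps q N. cyc q N b \<subseteq> \<Delta>}.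
        {hom_trace q N d b (monom (\<xi> b ^ r) b) | r. 0 \<le> r \<and> r \<le> cyc_card q N b - 1})) (PRS_sub q N \<Delta>)"
      using basis unfolding B_def[symmetric] by (rule subst)
  qed
qed

end
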